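(* Let $n\ge2$ and $d\ge 0$. The dimension of $((V^{(n-1,1)})^{\otimes d})^{\mathfrak S_n}\simeq\mathbb Q\langle Y_{n-1}\rangle_d^{\mathfrak S_n}$ is equal to the number of words of length $d$ which reduce to the identity in the Cayley graph $\Gamma(\mathfrak S_n,\{(1\,2),(1\,3\,2),\dots,(1\,n\,\cdots\,4\,3\,2)\})$.
   Context: $\mathfrak S_n$ is the symmetric group on $\{1,\dots,n\}$. $V^{(n-1,1)}$ is the geometric $\mathfrak S_n$-module: the $\mathbb Q$-span of $y_i=x_i-x_{i+1}$, $1\le i\le n-1$, inside the permutation module with basis $x_1,\dots,x_n$ on which $\mathfrak S_n$ permutes the $x_i$. $\mathfrak S_n$ acts diagonally on tensor powers; $(\cdot)^{\mathfrak S_n}$ denotes the subspace of invariants. The tensor algebra $T(V^{(n-1,1)})$ is identified with the non-commutative polynomial algebra $\mathbb Q\langle Y_{n-1}\rangle=\mathbb Q\langle y_1,\dots,y_{n-1}\rangle$, and the subscript $d$ denotes the homogeneous component of degree $d$. The set of generators is $S=\{c_2,\dots,c_n\}$, where $c_k=(1\;k\;k-1\;\cdots\;2)$ in cycle notation (so $c_2=(1\,2)$, $c_3=(1\,3\,2)$, $c_4=(1\,4\,3\,2)$). In the Cayley graph $\Gamma(G,S)$ there is a directed edge $g\to gs$ for each $g\in G$, $s\in S$; a word of length $d$ which reduces to $g$ is a sequence $(s_1,\dots,s_d)\in S^d$ with $s_1\cdots s_d=g$ in $G$. *)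

theory Defs
  imports Complex_Main "HOL-Algebra.Sym_Groups" "HOL-Library.Poly_Mapping"
begin

instantiation list :: (type) monoid_add
begin

definition zero_list :: "'a list" where "zero_list = []"

definition plus_list :: "'a list \<Rightarrow> 'a list \<Rightarrow> 'a list" where "plus_list = (@)"

instance
  by standard (simp_all add: zero_list_def plus_list_def)

end

text \<open>
  With lists forming the free monoid, the convolution product of
  \<^theory>\<open>HOL-Library.Poly_Mapping\<close> turns the following type into the free associative
  algebra over the rationals on letters indexed by \<^typ>\<open>nat\<close>. It plays two roles below:
  the tensor algebra of the permutation module (letter \<open>i\<close> is \<open>x\<^sub>i\<close>, the product is the tensor
  product) and the algebra of non-commutative polynomials (letter \<open>i\<close> is \<open>y\<^sub>i\<close>).
\<close>

type_synonym free_alg = "nat list \<Rightarrow>\<^sub>0 rat"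

definition scale :: "rat \<Rightarrow> free_alg \<Rightarrow> free_alg" where
  "scale c f = Poly_Mapping.map ((*) c) f"

lemma lookup_scale: "Poly_Mapping.lookup (scale c f) w = c * Poly_Mapping.lookup f w"
  by (simp add: scale_def map.rep_eq when_def)

global_interpretation fa: vector_space scale
  by standard (auto intro!: poly_mapping_eqI simp: lookup_scale lookup_add algebra_simps)

definition gen :: "nat \<Rightarrow> free_alg" where
  "gen i = Poly_Mapping.single [i] 1"

text \<open>The unique algebra endomorphism sending each letter \<open>i\<close> to \<open>h i\<close>.\<close>

definition free_subst :: "(nat \<Rightarrow> free_alg) \<Rightarrow> free_alg \<Rightarrow> free_alg" where
  "free_subst h f = (\<Sum>w\<in>Poly_Mapping.keys f. scale (Poly_Mapping.lookup f w) (prod_list (map h w)))"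

definition invariants ::
  "nat \<Rightarrow> ((nat \<Rightarrow> nat) \<Rightarrow> free_alg \<Rightarrow> free_alg) \<Rightarrow> free_alg set \<Rightarrow> free_alg set" where
  "invariants n act W = {f \<in> W. \<forall>\<sigma>\<in>carrier (sym_group n). act \<sigma> f = f}"


subsection \<open>The geometric module and its tensor powers\<close>

definition geometric_module :: "nat \<Rightarrow> free_alg set" where
  "geometric_module n = fa.span ((\<lambda>i. gen i - gen (i + 1)) ` {1..n - 1})"

text \<open>
  The tensor power of a subspace \<open>V\<close> of the span of the letters, realised inside the tensor
  power of the ambient space as the span of the elementary tensors (over a field, the tensor
  power of \<open>V\<close> embeds there). For \<open>d = 0\<close> this is the line spanned by \<open>1\<close>.
\<close>

definition tensor_power :: "free_alg set \<Rightarrow> nat \<Rightarrow> free_alg set" where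
  "tensor_power V d = fa.span {prod_list vs | vs. length vs = d \<and> set vs \<subseteq> V}"

definition diagonal_action :: "(nat \<Rightarrow> nat) \<Rightarrow> free_alg \<Rightarrow> free_alg" where
  "diagonal_action \<sigma> = free_subst (\<lambda>i. gen (\<sigma> i))"


subsection \<open>Non-commutative polynomials\<close>

definition nc_homogeneous :: "nat \<Rightarrow> nat \<Rightarrow> free_alg set" where
  "nc_homogeneous m d = {f. \<forall>w\<in>Poly_Mapping.keys f. length w = d \<and> set w \<subseteq> {1..m}}"

text \<open>
  The element \<open>x\<^sub>a - x\<^sub>b\<close> written in the \<open>y\<^sub>j = x\<^sub>j - x\<^bsub>j+1\<^esub>\<close>. At most one of the sums is nonempty.
\<close>

definition y_diff :: "nat \<Rightarrow> nat \<Rightarrow> free_alg" where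
  "y_diff a b = (\<Sum>j\<in>{a..<b}. gen j) - (\<Sum>j\<in>{b..<a}. gen j)"

text \<open>Since \<open>\<sigma> y\<^sub>i = x\<^bsub>\<sigma> i\<^esub> - x\<^bsub>\<sigma> (i+1)\<^esub>\<close>:\<close>

definition nc_action :: "(nat \<Rightarrow> nat) \<Rightarrow> free_alg \<Rightarrow> free_alg" where
  "nc_action \<sigma> = free_subst (\<lambda>i. y_diff (\<sigma> i) (\<sigma> (i + 1)))"

text \<open>
  The identification of non-commutative polynomials in the \<open>y\<^sub>i\<close> with tensors:
  the monomial \<open>y\<^bsub>i\<^esub> \<cdots> y\<^bsub>j\<^esub>\<close> goes to the tensor product of \<open>x\<^bsub>i\<^esub> - x\<^bsub>i+1\<^esub>, \<dots>, x\<^bsub>j\<^esub> - x\<^bsub>j+1\<^esub>\<close>.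
\<close>

definition nc_to_tensor :: "free_alg \<Rightarrow> free_alg" where
  "nc_to_tensor = free_subst (\<lambda>i. gen i - gen (i + 1))"


subsection \<open>Words in the Cayley graph\<close>

definition words_reducing_to :: "('a, 'b) monoid_scheme \<Rightarrow> 'a set \<Rightarrow> nat \<Rightarrow> 'a \<Rightarrow> 'a list set" where
  "words_reducing_to G S d g =
     {ws. length ws = d \<and> set ws \<subseteq> S \<and> foldr (mult G) ws (one G) = g}"

text \<open>The cycle \<open>(1 k k-1 \<cdots> 2)\<close>, sending \<open>1\<close> to \<open>k\<close> and \<open>j\<close> to \<open>j - 1\<close> for \<open>2 \<le> j \<le> k\<close>.\<close>

definition down_cycle :: "nat \<Rightarrow> nat \<Rightarrow> nat" where
  "down_cycle k = cycle_of_list (1 # rev [2..<k + 1])"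

definition cycle_generators :: "nat \<Rightarrow> (nat \<Rightarrow> nat) set" where
  "cycle_generators n = down_cycle ` {2..n}"

end

theory Submission
  imports Defs
begin

text \<open>
  Both sides of the dimension formula are computed by the same two-parameter recursion. Write
  \<open>P\<close> for the permutation module with basis \<open>x\<^sub>1, \<dots>, x\<^sub>n\<close> and \<open>V\<close> for the geometric module.

  On the algebraic side, let \<open>\<epsilon>\<^sub>i\<close> be the contraction of the \<open>i\<close>-th tensor factor of \<open>P\<^sup>\<otimes>\<^sup>d\<close> along the
  augmentation \<open>x\<^sub>a \<mapsto> 1\<close>. Since \<open>V\<close> is the kernel of the augmentation, \<open>V\<^sup>\<otimes>\<^sup>d\<close> is the common kernel
  of all the \<open>\<epsilon>\<^sub>i\<close> (\<open>tensor_power_geometric_module\<close>). Let \<open>U(j,d)\<close> be the space of invariants of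
  \<open>P\<^sup>\<otimes>\<^sup>d\<close> killed by the first \<open>j\<close> contractions. The next contraction maps \<open>U(j,d+1)\<close> onto \<open>U(j,d)\<close>,
  because inserting \<open>(x\<^sub>1 + \<dots> + x\<^sub>n)/n\<close> is an equivariant section of it, and its kernel is
  \<open>U(j+1,d+1)\<close>; hence \<open>dim U(j,d+1) = dim U(j+1,d+1) + dim U(j,d)\<close>
  (\<open>dim_partial_invariants_step\<close>).

  On the combinatorial side, put \<open>c\<^sub>1 = id\<close> and count the words of length \<open>d\<close> in \<open>c\<^sub>1, \<dots>, c\<^sub>n\<close> which
  reduce to the identity and whose first \<open>j\<close> letters differ from \<open>c\<^sub>1\<close>. Deleting an identity letter
  at the next position shows that these numbers satisfy the same recursion
  (\<open>monoid.card_partial_words_step\<close>). For \<open>j = d\<close> the two families are the numbers to be compared,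
  so only \<open>j = 0\<close> remains.

  For \<open>j = 0\<close> the dimension is the number of orbits of the symmetric group on \<open>{1..n}\<^sup>d\<close>. The word
  \<open>c\<^bsub>k\<^esub> c\<^bsub>l\<^esub> \<cdots>\<close> is read as a shuffle of a deck of \<open>n\<close> labelled cards, starting in the order
  \<open>1, \<dots>, n\<close>: the \<open>k\<close>-th card from the top is moved to the top, then the \<open>l\<close>-th one, and so on.
  Recording the labels of the moved cards is a bijection from words to sequences in \<open>{1..n}\<^sup>d\<close>. In
  the final deck the moved cards come first, the most recently moved one on top, followed by the
  others in their original order (\<open>deck_after_labels\<close>). So the word reduces to the identity iff
  that particular rearrangement is \<open>1, \<dots>, n\<close>, and each orbit of label sequences contains exactly
  one sequence with this property (\<open>canonical_word_exists\<close>, \<open>canonical_word_unique\<close>).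

  Finally, writing a tensor in \<open>V\<^sup>\<otimes>\<^sup>d\<close> as a polynomial in the \<open>y\<^sub>i\<close> is done by the substitution
  \<open>x\<^sub>a \<mapsto> x\<^sub>a - x\<^sub>n\<close>, which fixes all such tensors; this inverts the identification of non-commutative
  polynomials with tensors.
\<close>

section \<open>Linear algebra in a space of infinite dimension\<close>

lemma (in vector_space) span_disjoint_trivial:
  assumes "independent (K \<union> L)" "K \<inter> L = {}" "z \<in> span K" "z \<in> span L"
  shows "z = 0"
proof -
  let ?r = "representation (K \<union> L) z"
  have K: "?r = representation K z" and L: "?r = representation L z"
    using assms by (auto intro: representation_extend)
  have "?r b = 0" for b
    using representation_ne_zero[of K z b] representation_ne_zero[of L z b] K L assms(2) by force
  moreover have "z \<in> span (K \<union> L)"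
    using assms(3) span_mono[of K "K \<union> L"] by blast
  ultimately show "z = 0"
    using sum_nonzero_representation_eq[OF assms(1), of z] by simp
qed

text \<open>
  The free algebra has infinite dimension, so rank and nullity are related for a subspace that is
  spanned by finitely many vectors. A basis \<open>K\<close> of the kernel is extended to a basis \<open>B\<close> of \<open>U\<close>;
  the map is injective on the span of \<open>B - K\<close>, because that span meets the kernel trivially.
\<close>

lemma (in vector_space_pair) rank_nullity_subspace:
  assumes f: "Vector_Spaces.linear s1 s2 f" and U: "vs1.subspace U"
    and T: "finite T" "U \<subseteq> vs1.span T"
  shows "vs1.dim U = vs1.dim {x \<in> U. f x = 0} + vs2.dim (f ` U)"
proof -
  interpret f: Vector_Spaces.linear s1 s2 f by fact
  let ?N = "{x \<in> U. f x = 0}"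
  obtain K where K: "K \<subseteq> ?N" "vs1.independent K" "?N \<subseteq> vs1.span K" "card K = vs1.dim ?N"
    by (rule vs1.basis_exists)
  obtain B where B: "K \<subseteq> B" "B \<subseteq> U" "vs1.independent B" "U \<subseteq> vs1.span B"
    using vs1.maximal_independent_subset_extend[of K U] K by blast
  have fB: "finite B"
    using vs1.independent_span_bound[OF T(1) B(3)] B(2) T(2) by blast
  let ?L = "B - K"
  have LU: "vs1.span ?L \<subseteq> U"
    using B(2) U by (meson Diff_subset order_trans vs1.span_minimal)
  have inj: "inj_on f (vs1.span ?L)"
  proof (rule inj_onI)
    fix x y assume xy: "x \<in> vs1.span ?L" "y \<in> vs1.span ?L" "f x = f y"
    then have D: "x - y \<in> vs1.span ?L" by (simp add: vs1.span_diff)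
    moreover have "x - y \<in> ?N" using D LU xy(3) by (auto simp: f.diff)
    ultimately have "x - y = 0"
      using vs1.span_disjoint_trivial[of K ?L "x - y"] K(3) B(1,3) by (auto simp: Un_absorb1)
    then show "x = y" by simp
  qed
  have "vs2.independent (f ` ?L)"
    by (rule linear_independent_injective_image[OF f _ inj])
       (use B(3) vs1.independent_mono in blast)
  moreover have "f ` U \<subseteq> vs2.span (f ` ?L)"
  proof
    fix y assume "y \<in> f ` U"
    then obtain x where x: "x \<in> U" "y = f x" by blast
    then have "f x \<in> f ` vs1.span B" using B(4) by blast
    then have "f x \<in> vs2.span (f ` B)" by (simp add: f.span_image)
    moreover have "f ` B \<subseteq> vs2.span (f ` ?L)"
    proof
      fix z assume "z \<in> f ` B"
      then obtain b where b: "b \<in> B" "z = f b" by blast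
      show "z \<in> vs2.span (f ` ?L)"
      proof (cases "b \<in> K")
        case True
        then have "f b = 0" using K(1) by blast
        then show ?thesis using b vs2.span_zero by simp
      next
        case False
        then show ?thesis using b by (auto intro: vs2.span_base)
      qed
    qed
    ultimately show "y \<in> vs2.span (f ` ?L)"
      using x(2) vs2.span_minimal[of "f ` B" "vs2.span (f ` ?L)"] by auto
  qed
  moreover have "f ` ?L \<subseteq> f ` U" using B(2) by blast
  ultimately have "vs2.dim (f ` U) = card (f ` ?L)"
    by (metis vs2.basis_card_eq_dim)
  also have "\<dots> = card ?L"
    by (rule card_image) (rule inj_on_subset[OF inj], auto intro: vs1.span_base)
  finally have "vs2.dim (f ` U) = card ?L" .
  moreover have "vs1.dim U = card B" using B vs1.basis_card_eq_dim by metis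
  ultimately show ?thesis
    using K(4) B(1) fB by (metis card_Diff_subset card_mono finite_subset le_add_diff_inverse)
qed

interpretation fp: vector_space_pair scale scale ..

section \<open>Linear extension of functions on words\<close>

definition lin_ext :: "(nat list \<Rightarrow> free_alg) \<Rightarrow> free_alg \<Rightarrow> free_alg" where
  "lin_ext g f = (\<Sum>w\<in>Poly_Mapping.keys f. scale (Poly_Mapping.lookup f w) (g w))"

lemma free_subst_lin_ext: "free_subst h = lin_ext (\<lambda>w. prod_list (map h w))"
  by (simp add: fun_eq_iff free_subst_def lin_ext_def)

lemma lin_ext_superset:
  assumes "finite A" "Poly_Mapping.keys f \<subseteq> A"
  shows "lin_ext g f = (\<Sum>w\<in>A. scale (Poly_Mapping.lookup f w) (g w))"
  unfolding lin_ext_def using assms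
  by (intro sum.mono_neutral_left) (auto simp: in_keys_iff)

lemma lin_ext_add [simp]: "lin_ext g (f1 + f2) = lin_ext g f1 + lin_ext g f2"
proof -
  let ?A = "Poly_Mapping.keys f1 \<union> Poly_Mapping.keys f2"
  show ?thesis
    using lin_ext_superset[of ?A f1 g] lin_ext_superset[of ?A f2 g]
      lin_ext_superset[of ?A "f1 + f2" g] keys_add[of f1 f2]
    by (simp add: lookup_add fa.scale_left_distrib sum.distrib)
qed

lemma keys_scale: "Poly_Mapping.keys (scale c f) \<subseteq> Poly_Mapping.keys f"
  by (auto simp: in_keys_iff lookup_scale)

lemma lin_ext_scale [simp]: "lin_ext g (scale c f) = scale c (lin_ext g f)"
  using lin_ext_superset[OF finite_keys keys_scale, of g c f]
  by (simp add: lookup_scale lin_ext_def fa.scale_sum_right)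

lemma linear_lin_ext: "Vector_Spaces.linear scale scale (lin_ext g)"
  by (simp add: Vector_Spaces.linear_iff fa.vector_space_axioms)

lemma lin_ext_zero [simp]: "lin_ext g 0 = 0"
  by (simp add: lin_ext_def)

lemma lin_ext_diff [simp]: "lin_ext g (f1 - f2) = lin_ext g f1 - lin_ext g f2"
  using lin_ext_add[of g "f1 - f2" f2] by simp

lemma lin_ext_sum [simp]: "lin_ext g (sum F A) = (\<Sum>x\<in>A. lin_ext g (F x))"
  by (induction A rule: infinite_finite_induct) simp_all

lemma lin_ext_single [simp]: "lin_ext g (Poly_Mapping.single w 1) = g w"
  by (simp add: lin_ext_def)

lemma lin_ext_cong: "(\<And>w. w \<in> Poly_Mapping.keys f \<Longrightarrow> g w = h w) \<Longrightarrow> lin_ext g f = lin_ext h f"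
  by (simp add: lin_ext_def)

lemma lin_ext_words [simp]: "lin_ext (\<lambda>w. Poly_Mapping.single w 1) f = f"
proof (rule poly_mapping_eqI)
  fix v
  have "Poly_Mapping.lookup (lin_ext (\<lambda>w. Poly_Mapping.single w 1) f) v =
    (\<Sum>w\<in>Poly_Mapping.keys f. if v = w then Poly_Mapping.lookup f w else 0)"
    unfolding lin_ext_def lookup_sum lookup_scale
    by (rule sum.cong) (auto simp: lookup_single when_def)
  also have "\<dots> = Poly_Mapping.lookup f v"
    by (simp add: in_keys_iff)
  finally show "Poly_Mapping.lookup (lin_ext (\<lambda>w. Poly_Mapping.single w 1) f) v = Poly_Mapping.lookup f v" .
qed

lemma lin_ext_comp: "lin_ext g (lin_ext h f) = lin_ext (\<lambda>w. lin_ext g (h w)) f"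
  by (simp add: lin_ext_def[of h] lin_ext_def[of "\<lambda>w. lin_ext g (h w)"])

lemma lin_ext_diff_fun: "lin_ext (\<lambda>w. g w - h w) f = lin_ext g f - lin_ext h f"
  by (simp add: lin_ext_def fa.scale_right_diff_distrib sum_subtractf)

lemma lin_ext_zero_fun [simp]: "lin_ext (\<lambda>w. 0) f = 0"
  by (simp add: lin_ext_def)

section \<open>Substitutions are algebra homomorphisms\<close>

lemma scale_conv_times: "scale c f = Poly_Mapping.single [] c * f"
  by (simp add: scale_def zero_list_def mult_map_scale_conv_mult)

lemma single_Nil: "Poly_Mapping.single [] 1 = (1 :: free_alg)"
  by (metis single_one zero_list_def)

lemma single_mult_word: "Poly_Mapping.single u 1 * Poly_Mapping.single v 1 = (Poly_Mapping.single (u @ v) 1 :: free_alg)"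
  by (simp add: mult_single plus_list_def)

lemma scale_mult_left: "scale c f * g = scale c (f * g)"
  by (simp add: scale_conv_times mult.assoc)

lemma scale_mult_right: "f * scale c g = scale c (f * g)" for f g :: free_alg
proof -
  have "f * Poly_Mapping.single [] c = Poly_Mapping.single [] c * f"
  proof -
    let ?X = "Poly_Mapping.single [] c :: free_alg"
    have "f * ?X = lin_ext (\<lambda>w. Poly_Mapping.single w 1) f * ?X" by simp
    then have 1: "f * ?X = (\<Sum>w\<in>Poly_Mapping.keys f. scale (Poly_Mapping.lookup f w) (Poly_Mapping.single w 1 * ?X))"
      unfolding lin_ext_def by (simp only: sum_distrib_right scale_mult_left)
    have 2: "Poly_Mapping.single w 1 * Poly_Mapping.single [] c = (scale c (Poly_Mapping.single w 1) :: free_alg)" for w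
      by (simp add: scale_conv_times mult_single plus_list_def)
    have "f * ?X = scale c (lin_ext (\<lambda>w. Poly_Mapping.single w 1) f)"
      unfolding 1 by (simp add: lin_ext_def 2 fa.scale_sum_right mult.commute del: lin_ext_words)
    then show ?thesis by (simp add: scale_conv_times)
  qed
  then show ?thesis by (simp add: scale_conv_times flip: mult.assoc)
qed

lemma lin_ext_times:
  assumes "\<And>u v. g (u @ v) = g u * g v"
  shows "lin_ext g (f1 * f2) = lin_ext g f1 * lin_ext g f2"
proof -
  have "f1 * f2 = lin_ext (\<lambda>w. Poly_Mapping.single w 1) f1 * lin_ext (\<lambda>w. Poly_Mapping.single w 1) f2"
    by simp
  also have "\<dots> = (\<Sum>u\<in>Poly_Mapping.keys f1. \<Sum>v\<in>Poly_Mapping.keys f2.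
      scale (Poly_Mapping.lookup f1 u) (scale (Poly_Mapping.lookup f2 v) (Poly_Mapping.single (u @ v) 1)))"
    unfolding lin_ext_def
    by (simp add: sum_product scale_mult_left scale_mult_right single_mult_word mult.commute)
  finally have "lin_ext g (f1 * f2) = (\<Sum>u\<in>Poly_Mapping.keys f1. \<Sum>v\<in>Poly_Mapping.keys f2.
      scale (Poly_Mapping.lookup f1 u) (scale (Poly_Mapping.lookup f2 v) (g u * g v)))"
    by (simp add: assms)
  then show ?thesis
    unfolding lin_ext_def by (simp add: sum_product scale_mult_left scale_mult_right mult.commute)
qed

lemma free_subst_times: "free_subst h (f1 * f2) = free_subst h f1 * free_subst h f2"
  unfolding free_subst_lin_ext by (rule lin_ext_times) simp

lemma free_subst_gen [simp]: "free_subst h (gen i) = h i"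
  by (simp add: free_subst_lin_ext gen_def)

lemma free_subst_one: "free_subst h 1 = 1"
  using lin_ext_single[of "\<lambda>w. prod_list (map h w)" "[]"]
  by (simp add: free_subst_lin_ext single_Nil)

lemma free_subst_prod_list: "free_subst h (prod_list fs) = prod_list (map (free_subst h) fs)"
  by (induction fs) (simp_all add: free_subst_one free_subst_times)

lemma free_subst_comp: "free_subst h (free_subst g f) = free_subst (\<lambda>i. free_subst h (g i)) f"
  unfolding free_subst_lin_ext[of g] free_subst_lin_ext[of "\<lambda>i. free_subst h (g i)"]
  by (subst free_subst_lin_ext, subst lin_ext_comp)
     (simp flip: free_subst_lin_ext add: free_subst_prod_list o_def)

lemma prod_list_gen: "prod_list (map (\<lambda>i. gen (h i)) w) = Poly_Mapping.single (map h w) 1"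
  by (induction w) (simp_all add: gen_def single_mult_word single_Nil)

lemma free_subst_cong:
  "(\<And>w i. w \<in> Poly_Mapping.keys f \<Longrightarrow> i \<in> set w \<Longrightarrow> g i = h i) \<Longrightarrow> free_subst g f = free_subst h f"
  unfolding free_subst_lin_ext by (intro lin_ext_cong arg_cong[of _ _ prod_list]) auto

lemma free_subst_id: "free_subst gen f = f"
  using prod_list_gen[of "\<lambda>i. i"] by (simp add: free_subst_lin_ext)

section \<open>Homogeneous components\<close>

lemma lin_ext_in_subspace:
  "fa.subspace S \<Longrightarrow> (\<And>w. w \<in> Poly_Mapping.keys f \<Longrightarrow> g w \<in> S) \<Longrightarrow> lin_ext g f \<in> S"
  unfolding lin_ext_def by (intro fa.subspace_sum fa.subspace_scale)

definition words_over :: "nat \<Rightarrow> nat \<Rightarrow> nat list set" where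
  "words_over m d = {w. length w = d \<and> set w \<subseteq> {1..m}}"

lemma finite_words_over: "finite (words_over m d)"
  unfolding words_over_def using finite_lists_length_eq[of "{1..m}" d] by (simp add: conj_commute)

lemma map_permutes_words_over:
  assumes "w \<in> words_over n d" "\<sigma> permutes {1..n}"
  shows "map \<sigma> w \<in> words_over n d"
  using assms permutes_in_image[OF assms(2)] by (auto simp: words_over_def subset_iff)

lemma nc_homogeneous_iff: "f \<in> nc_homogeneous m d \<longleftrightarrow> Poly_Mapping.keys f \<subseteq> words_over m d"
  by (auto simp: nc_homogeneous_def words_over_def)

lemma subspace_nc_homogeneous: "fa.subspace (nc_homogeneous m d)"
  unfolding fa.subspace_def
  by (auto simp: nc_homogeneous_iff dest!: subsetD[OF keys_add] subsetD[OF keys_scale])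

lemma word_in_nc_homogeneous: "Poly_Mapping.single w 1 \<in> nc_homogeneous m d \<longleftrightarrow> w \<in> words_over m d"
  by (simp add: nc_homogeneous_iff)

lemma gen_in_nc_homogeneous: "i \<in> {1..m} \<Longrightarrow> gen i \<in> nc_homogeneous m 1"
  by (simp add: gen_def word_in_nc_homogeneous words_over_def)

lemma nc_homogeneous_times:
  assumes "f \<in> nc_homogeneous m d" "g \<in> nc_homogeneous m e"
  shows "f * g \<in> nc_homogeneous m (d + e)"
  using keys_mult[of f g] assms
  by (fastforce simp: nc_homogeneous_iff words_over_def plus_list_def)

lemma nc_homogeneous_prod_list:
  "set vs \<subseteq> nc_homogeneous m 1 \<Longrightarrow> prod_list vs \<in> nc_homogeneous m (length vs)"
proof (induction vs)
  case Nil
  show ?case by (simp add: word_in_nc_homogeneous words_over_def flip: single_Nil)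
next
  case (Cons v vs)
  then show ?case using nc_homogeneous_times[of v m 1 "prod_list vs" "length vs"] by simp
qed

lemma nc_homogeneous_free_subst:
  assumes "f \<in> nc_homogeneous k d" "\<And>i. i \<in> {1..k} \<Longrightarrow> h i \<in> nc_homogeneous m 1"
  shows "free_subst h f \<in> nc_homogeneous m d"
  unfolding free_subst_lin_ext
proof (rule lin_ext_in_subspace[OF subspace_nc_homogeneous])
  fix w assume "w \<in> Poly_Mapping.keys f"
  then have w: "length w = d" "set w \<subseteq> {1..k}"
    using assms(1) by (auto simp: nc_homogeneous_iff words_over_def)
  then have "set (map h w) \<subseteq> nc_homogeneous m 1"
    using assms(2) by (auto simp del: One_nat_def)
  then show "prod_list (map h w) \<in> nc_homogeneous m d"
    using nc_homogeneous_prod_list[of "map h w" m] w(1) by simp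
qed

lemma nc_homogeneous_subset_span:
  "nc_homogeneous m d \<subseteq> fa.span ((\<lambda>w. Poly_Mapping.single w 1) ` words_over m d)"
proof
  fix f assume "f \<in> nc_homogeneous m d"
  then have "lin_ext (\<lambda>w. Poly_Mapping.single w 1) f \<in> fa.span ((\<lambda>w. Poly_Mapping.single w 1) ` words_over m d)"
    by (intro lin_ext_in_subspace fa.subspace_span fa.span_base) (auto simp: nc_homogeneous_iff)
  then show "f \<in> fa.span ((\<lambda>w. Poly_Mapping.single w 1) ` words_over m d)" by simp
qed

lemma rank_nullity_homogeneous:
  assumes "Vector_Spaces.linear scale scale f" "fa.subspace U" "U \<subseteq> nc_homogeneous m d"
  shows "fa.dim U = fa.dim {x \<in> U. f x = 0} + fa.dim (f ` U)"
  using fp.rank_nullity_subspace[OF assms(1,2), of "(\<lambda>w. Poly_Mapping.single w 1) ` words_over m d"]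
    finite_words_over nc_homogeneous_subset_span assms(3) by blast

section \<open>Contracting and expanding tensors\<close>

fun del_nth :: "nat \<Rightarrow> 'a list \<Rightarrow> 'a list" where
  "del_nth i [] = []"
| "del_nth 0 (a # w) = w"
| "del_nth (Suc i) (a # w) = a # del_nth i w"

fun ins_nth :: "nat \<Rightarrow> 'a \<Rightarrow> 'a list \<Rightarrow> 'a list" where
  "ins_nth 0 a w = a # w"
| "ins_nth (Suc i) a [] = [a]"
| "ins_nth (Suc i) a (b # w) = b # ins_nth i a w"

lemma length_del_nth: "i < length w \<Longrightarrow> length (del_nth i w) = length w - 1"
  by (induction i w rule: del_nth.induct) auto

lemma set_del_nth: "set (del_nth i w) \<subseteq> set w"
  by (induction i w rule: del_nth.induct) auto

lemma length_ins_nth [simp]: "length (ins_nth i a w) = Suc (length w)"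
  by (induction i a w rule: ins_nth.induct) auto

lemma set_ins_nth [simp]: "set (ins_nth i a w) = insert a (set w)"
  by (induction i a w rule: ins_nth.induct) auto

lemma map_del_nth: "map f (del_nth i w) = del_nth i (map f w)"
  by (induction i w rule: del_nth.induct) auto

lemma map_ins_nth: "map f (ins_nth i a w) = ins_nth i (f a) (map f w)"
  by (induction i a w rule: ins_nth.induct) auto

lemma del_ins_same: "i \<le> length w \<Longrightarrow> del_nth i (ins_nth i a w) = w"
  by (induction i a w rule: ins_nth.induct) auto

lemma del_del: "i \<le> j \<Longrightarrow> Suc j < length w \<Longrightarrow> del_nth i (del_nth (Suc j) w) = del_nth j (del_nth i w)"
proof (induction i w arbitrary: j rule: del_nth.induct)
  case (3 i a w)
  then show ?case by (cases j) auto
qed auto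

lemma del_ins: "i \<le> j \<Longrightarrow> j < length w \<Longrightarrow> del_nth i (ins_nth (Suc j) a w) = ins_nth j a (del_nth i w)"
proof (induction i w arbitrary: j rule: del_nth.induct)
  case (3 i b w)
  then show ?case by (cases j) auto
qed auto

text \<open>
  Applying the augmentation \<open>x\<^sub>a \<mapsto> 1\<close> to the \<open>i\<close>-th tensor factor (counted from \<open>0\<close>), respectively
  inserting the invariant vector \<open>x\<^sub>1 + \<dots> + x\<^sub>n\<close> as a new \<open>i\<close>-th factor. The former is meaningful
  only in degrees greater than \<open>i\<close>, the latter in degrees at least \<open>i\<close>.
\<close>

definition contract :: "nat \<Rightarrow> free_alg \<Rightarrow> free_alg" where
  "contract i = lin_ext (\<lambda>w. Poly_Mapping.single (del_nth i w) 1)"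

definition expand :: "nat \<Rightarrow> nat \<Rightarrow> free_alg \<Rightarrow> free_alg" where
  "expand n i = lin_ext (\<lambda>w. \<Sum>a\<in>{1..n}. Poly_Mapping.single (ins_nth i a w) 1)"

lemma diagonal_action_lin_ext: "diagonal_action \<sigma> = lin_ext (\<lambda>w. Poly_Mapping.single (map \<sigma> w) 1)"
  by (simp add: diagonal_action_def free_subst_lin_ext prod_list_gen)

lemma contract_homogeneous:
  assumes "f \<in> nc_homogeneous m (Suc d)" "i \<le> d"
  shows "contract i f \<in> nc_homogeneous m d"
  unfolding contract_def
  by (rule lin_ext_in_subspace[OF subspace_nc_homogeneous])
     (use assms set_del_nth in \<open>fastforce simp: nc_homogeneous_iff words_over_def length_del_nth\<close>)

lemma expand_homogeneous:
  assumes "f \<in> nc_homogeneous n d"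
  shows "expand n i f \<in> nc_homogeneous n (Suc d)"
  unfolding expand_def
  by (intro lin_ext_in_subspace[OF subspace_nc_homogeneous] fa.subspace_sum[OF subspace_nc_homogeneous])
     (use assms in \<open>auto simp: nc_homogeneous_iff words_over_def\<close>)

lemma contract_contract:
  assumes "f \<in> nc_homogeneous m d" "i \<le> j" "Suc j < d"
  shows "contract i (contract (Suc j) f) = contract j (contract i f)"
  unfolding contract_def lin_ext_comp lin_ext_single
  by (rule lin_ext_cong)
     (use assms in \<open>auto simp: del_del nc_homogeneous_iff words_over_def\<close>)

lemma contract_expand:
  assumes "f \<in> nc_homogeneous m d" "i \<le> j" "j < d"
  shows "contract i (expand n (Suc j) f) = expand n j (contract i f)"
  unfolding contract_def expand_def lin_ext_comp lin_ext_single lin_ext_sum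
  by (intro lin_ext_cong sum.cong)
     (use assms in \<open>auto simp: del_ins nc_homogeneous_iff words_over_def\<close>)

lemma contract_expand_same:
  assumes "f \<in> nc_homogeneous m d" "j \<le> d"
  shows "contract j (expand n j f) = scale (of_nat n) f"
proof -
  have "contract j (expand n j f) = lin_ext (\<lambda>w. scale (of_nat n) (Poly_Mapping.single w 1)) f"
    unfolding contract_def expand_def lin_ext_comp lin_ext_single lin_ext_sum
  proof (rule lin_ext_cong)
    fix w assume "w \<in> Poly_Mapping.keys f"
    then have "j \<le> length w" using assms by (auto simp: nc_homogeneous_iff words_over_def)
    then show "(\<Sum>a = 1..n. Poly_Mapping.single (del_nth j (ins_nth j a w)) 1) =
         scale (of_nat n) (Poly_Mapping.single w 1)"
      by (simp add: del_ins_same fa.sum_constant_scale del: sum_constant)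
  qed
  also have "\<dots> = scale (of_nat n) (lin_ext (\<lambda>w. Poly_Mapping.single w 1) f)"
    by (simp add: lin_ext_def fa.scale_sum_right mult.commute del: lin_ext_words)
  finally show ?thesis by simp
qed

lemma contract_diagonal: "contract i (diagonal_action \<sigma> f) = diagonal_action \<sigma> (contract i f)"
  by (simp add: contract_def diagonal_action_lin_ext lin_ext_comp map_del_nth)

lemma expand_diagonal:
  assumes "\<sigma> permutes {1..n}"
  shows "diagonal_action \<sigma> (expand n i f) = expand n i (diagonal_action \<sigma> f)"
  unfolding expand_def diagonal_action_lin_ext lin_ext_comp lin_ext_single lin_ext_sum map_ins_nth
  by (rule lin_ext_cong) (rule sum.reindex_bij_betw[OF permutes_imp_bij[OF assms]])

text \<open>
  These spaces interpolate between the invariants of the tensor power of the permutation module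
  (\<open>j = 0\<close>) and those of the tensor power of the geometric module (\<open>j = d\<close>).
\<close>

definition partial_invariants :: "nat \<Rightarrow> nat \<Rightarrow> nat \<Rightarrow> free_alg set" where
  "partial_invariants n j d =
     {f \<in> invariants n diagonal_action (nc_homogeneous n d). \<forall>i<j. contract i f = 0}"

lemma subspace_partial_invariants: "fa.subspace (partial_invariants n j d)"
  using subspace_nc_homogeneous[of n d]
  by (auto simp: fa.subspace_def partial_invariants_def invariants_def contract_def diagonal_action_lin_ext)

text \<open>
  Surjectivity comes from averaging: inserting \<open>(x\<^sub>1 + \<dots> + x\<^sub>n)/n\<close> at position \<open>j\<close> preserves
  invariance and commutes with contractions at earlier positions, and contracting afterwards gives
  back the original tensor.
\<close>

lemma contract_image_partial_invariants:
  assumes "n \<ge> 1" "j \<le> d"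
  shows "contract j ` partial_invariants n j (Suc d) = partial_invariants n j d"
proof (intro equalityI subsetI)
  fix g assume "g \<in> contract j ` partial_invariants n j (Suc d)"
  then obtain f where f: "f \<in> nc_homogeneous n (Suc d)" "g = contract j f"
     "\<forall>\<sigma>\<in>carrier (sym_group n). diagonal_action \<sigma> f = f" "\<forall>i<j. contract i f = 0"
    by (auto simp: partial_invariants_def invariants_def)
  have "contract i g = 0" if ij: "i < j" for i
  proof -
    obtain k where k: "j = Suc k" using ij by (cases j) auto
    have "contract i g = contract k (contract i f)"
      using contract_contract[OF f(1), of i k] ij assms(2) k f(2) by simp
    then show ?thesis using f(4) ij by (simp add: contract_def)
  qed
  then show "g \<in> partial_invariants n j d"
    using f contract_homogeneous[OF f(1) assms(2)]
    by (auto simp: partial_invariants_def invariants_def contract_diagonal[symmetric])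
next
  fix f assume "f \<in> partial_invariants n j d"
  then have f: "f \<in> nc_homogeneous n d"
     "\<forall>\<sigma>\<in>carrier (sym_group n). diagonal_action \<sigma> f = f" "\<forall>i<j. contract i f = 0"
    by (auto simp: partial_invariants_def invariants_def)
  \<comment> \<open>The factor \<open>1/n\<close> compensates for contracting \<open>x\<^sub>1 + \<dots> + x\<^sub>n\<close> to \<open>n\<close>.\<close>
  define g where "g = expand n j (scale (1 / of_nat n) f)"
  let ?f = "scale (1 / of_nat n) f"
  have f': "?f \<in> nc_homogeneous n d" using f(1) subspace_nc_homogeneous fa.subspace_scale by blast
  have "contract i g = 0" if ij: "i < j" for i
  proof -
    obtain k where k: "j = Suc k" using ij by (cases j) auto
    have "contract i g = expand n k (contract i ?f)"
      using contract_expand[OF f', of i k] ij assms(2) k g_def by simp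
    then show ?thesis using f(3) ij by (simp add: contract_def expand_def)
  qed
  moreover have "diagonal_action \<sigma> g = g" if "\<sigma> \<in> carrier (sym_group n)" for \<sigma>
  proof -
    have "diagonal_action \<sigma> ?f = scale (1 / of_nat n) (diagonal_action \<sigma> f)"
      by (simp add: diagonal_action_lin_ext)
    then show ?thesis
      using that f(2) expand_diagonal[of \<sigma> n j ?f] by (simp add: g_def sym_group_carrier)
  qed
  ultimately have "g \<in> partial_invariants n j (Suc d)"
    using expand_homogeneous[OF f'] by (auto simp: partial_invariants_def invariants_def g_def)
  moreover have "contract j g = f"
    using contract_expand_same[OF f' assms(2)] assms(1) by (simp add: g_def)
  ultimately show "f \<in> contract j ` partial_invariants n j (Suc d)" by blast
qed

lemma dim_partial_invariants_step:
  assumes "n \<ge> 1" "j \<le> d"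
  shows "fa.dim (partial_invariants n j (Suc d)) =
         fa.dim (partial_invariants n (Suc j) (Suc d)) + fa.dim (partial_invariants n j d)"
proof -
  have "{f \<in> partial_invariants n j (Suc d). contract j f = 0} = partial_invariants n (Suc j) (Suc d)"
    by (auto simp: partial_invariants_def less_Suc_eq)
  moreover have "Vector_Spaces.linear scale scale (contract j)"
    unfolding contract_def by (rule linear_lin_ext)
  moreover have "partial_invariants n j (Suc d) \<subseteq> nc_homogeneous n (Suc d)"
    by (auto simp: partial_invariants_def invariants_def)
  ultimately show ?thesis
    using rank_nullity_homogeneous[OF _ subspace_partial_invariants, of "contract j" n j "Suc d" n "Suc d"]
      contract_image_partial_invariants[OF assms] by simp
qed

section \<open>The tensor power of the geometric module is a common kernel of contractions\<close>

text \<open>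
  The partial products interpolate between \<open>w\<close> and its image under the substitution
  \<open>x\<^sub>a \<mapsto> x\<^sub>a - x\<^sub>n\<close>: that substitution is applied to the first \<open>j\<close> letters only.
\<close>

fun shift_letters :: "nat \<Rightarrow> nat \<Rightarrow> nat list \<Rightarrow> free_alg" where
  "shift_letters n 0 w = Poly_Mapping.single w 1"
| "shift_letters n (Suc j) [] = 1"
| "shift_letters n (Suc j) (a # w) = (gen a - gen n) * shift_letters n j w"

lemma shift_letters_full: "shift_letters n (length w) w = prod_list (map (\<lambda>i. gen i - gen n) w)"
  by (induction w) (simp_all add: single_Nil)

lemma shift_letters_step:
  "j < length w \<Longrightarrow>
   shift_letters n (Suc j) w = shift_letters n j w - shift_letters n j (ins_nth j n (del_nth j w))"
proof (induction j w rule: del_nth.induct)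
  case (2 a w)
  show ?case by (simp add: gen_def left_diff_distrib single_mult_word)
next
  case (3 j a w)
  then show ?case by (simp add: right_diff_distrib)
qed simp

text \<open>
  Shifting one more letter changes a tensor by a term which depends only on its contraction at the
  position of that letter (\<open>shift_letters_step\<close>). If all contractions vanish, the letters can
  therefore be shifted one after the other without any change.
\<close>

lemma shift_fixes_contraction_kernel:
  assumes "f \<in> nc_homogeneous m d" "\<And>i. i < d \<Longrightarrow> contract i f = 0"
  shows "free_subst (\<lambda>i. gen i - gen n) f = f"
proof -
  have len: "w \<in> Poly_Mapping.keys f \<Longrightarrow> length w = d" for w
    using assms(1) by (auto simp: nc_homogeneous_iff words_over_def)
  have "j \<le> d \<Longrightarrow> lin_ext (shift_letters n j) f = f" for j
  proof (induction j)
    case 0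
    then show ?case by simp
  next
    case (Suc j)
    have "lin_ext (shift_letters n (Suc j)) f =
        lin_ext (\<lambda>w. shift_letters n j w - shift_letters n j (ins_nth j n (del_nth j w))) f"
      by (rule lin_ext_cong) (use len Suc.prems shift_letters_step in auto)
    also have "\<dots> = f - lin_ext (\<lambda>w. shift_letters n j (ins_nth j n w)) (contract j f)"
      using Suc by (simp add: lin_ext_diff_fun contract_def lin_ext_comp)
    also have "\<dots> = f" using assms(2)[of j] Suc.prems by simp
    finally show ?case .
  qed
  then have "f = lin_ext (shift_letters n d) f" by simp
  also have "\<dots> = free_subst (\<lambda>i. gen i - gen n) f"
    unfolding free_subst_lin_ext by (rule lin_ext_cong) (use len shift_letters_full in auto)
  finally show ?thesis by simp
qed

lemma contract_0_gen: "contract 0 (gen a * f) = f"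
proof -
  have "contract 0 (gen a * f) = contract 0 (gen a * lin_ext (\<lambda>w. Poly_Mapping.single w 1) f)" by simp
  also have "\<dots> = lin_ext (\<lambda>w. Poly_Mapping.single w 1) f"
    unfolding contract_def gen_def lin_ext_def[of _ f]
    by (simp add: sum_distrib_left scale_mult_right single_mult_word)
  finally show ?thesis by simp
qed

lemma contract_Suc_gen: "contract (Suc i) (gen a * f) = gen a * contract i f"
proof -
  have "contract (Suc i) (gen a * f) = contract (Suc i) (gen a * lin_ext (\<lambda>w. Poly_Mapping.single w 1) f)" by simp
  also have "\<dots> = gen a * contract i f"
    unfolding contract_def gen_def lin_ext_def[of _ f]
    by (simp add: sum_distrib_left scale_mult_right single_mult_word)
  finally show ?thesis .
qed

lemma contract_diff: "contract i (f - g) = contract i f - contract i g"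
  by (simp add: contract_def)

lemma contract_shifted_word:
  "i < length w \<Longrightarrow> contract i (prod_list (map (\<lambda>i. gen i - gen n) w)) = 0"
proof (induction i w rule: del_nth.induct)
  case (2 a w)
  show ?case by (simp add: left_diff_distrib contract_diff contract_0_gen)
next
  case (3 i a w)
  then show ?case by (simp add: left_diff_distrib contract_diff contract_Suc_gen)
qed simp

lemma gen_diff_in_geometric_module:
  assumes "a \<in> {1..n}"
  shows "gen a - gen n \<in> geometric_module n"
proof -
  have "a \<le> n" using assms by simp
  then show ?thesis using assms
  proof (induction rule: inc_induct)
    case base
    show ?case by (simp add: geometric_module_def fa.span_zero)
  next
    case (step a)
    have "gen a - gen (a + 1) \<in> geometric_module n"
      using step by (auto simp: geometric_module_def intro!: fa.span_base)
    then have "(gen a - gen (a + 1)) + (gen (Suc a) - gen n) \<in> geometric_module n"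
      using step unfolding geometric_module_def by (intro fa.span_add) auto
    then show ?case by simp
  qed
qed

lemma subspace_fixed: "fa.subspace {f. free_subst h f = f}"
  by (auto simp: fa.subspace_def free_subst_lin_ext)

lemma geometric_module_fixed: "geometric_module n \<subseteq> {v. free_subst (\<lambda>i. gen i - gen n) v = v}"
  unfolding geometric_module_def
proof (rule fa.span_minimal[OF _ subspace_fixed])
  have "free_subst h (f - g) = free_subst h f - free_subst h g" for h f g
    by (simp add: free_subst_lin_ext)
  then show "(\<lambda>i. gen i - gen (i + 1)) ` {1..n - 1} \<subseteq> {f. free_subst (\<lambda>i. gen i - gen n) f = f}"
    by auto
qed

lemma geometric_module_homogeneous: "geometric_module n \<subseteq> nc_homogeneous n 1"
  unfolding geometric_module_def
  by (rule fa.span_minimal[OF _ subspace_nc_homogeneous])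
     (auto intro!: fa.subspace_diff[OF subspace_nc_homogeneous] gen_in_nc_homogeneous simp del: One_nat_def)

lemma tensor_power_homogeneous: "tensor_power (geometric_module n) d \<subseteq> nc_homogeneous n d"
  unfolding tensor_power_def
  using nc_homogeneous_prod_list geometric_module_homogeneous
  by (intro fa.span_minimal[OF _ subspace_nc_homogeneous]) blast

lemma tensor_power_fixed:
  "tensor_power (geometric_module n) d \<subseteq> {f. free_subst (\<lambda>i. gen i - gen n) f = f}"
  unfolding tensor_power_def
proof (rule fa.span_minimal[OF _ subspace_fixed], safe)
  fix vs assume "set vs \<subseteq> geometric_module n"
  then have "map (free_subst (\<lambda>i. gen i - gen n)) vs = vs"
    using geometric_module_fixed by (intro map_idI) auto
  then show "free_subst (\<lambda>i. gen i - gen n) (prod_list vs) = prod_list vs"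
    by (simp add: free_subst_prod_list)
qed

lemma free_subst_in_tensor_power:
  assumes f: "f \<in> nc_homogeneous m d" and h: "\<And>i. i \<in> {1..m} \<Longrightarrow> h i \<in> V"
  shows "free_subst h f \<in> tensor_power V d"
  unfolding free_subst_lin_ext tensor_power_def
proof (intro lin_ext_in_subspace fa.subspace_span fa.span_base)
  fix w assume "w \<in> Poly_Mapping.keys f"
  then have "length (map h w) = d" "set (map h w) \<subseteq> V"
    using f h by (auto simp: nc_homogeneous_def subset_iff simp del: atLeastAtMost_iff)
  then show "prod_list (map h w) \<in> {prod_list vs | vs. length vs = d \<and> set vs \<subseteq> V}" by blast
qed

lemma free_subst_shift_in_tensor_power:
  assumes "f \<in> nc_homogeneous n d"
  shows "free_subst (\<lambda>i. gen i - gen n) f \<in> tensor_power (geometric_module n) d"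
  using assms gen_diff_in_geometric_module by (rule free_subst_in_tensor_power)

text \<open>
  For a homogeneous tensor, both conditions say that it is fixed by the substitution \<open>x\<^sub>a \<mapsto> x\<^sub>a - x\<^sub>n\<close>. This
  homomorphism fixes \<open>V\<close>, hence every product of elements of \<open>V\<close>; its values on words are products
  of elements of \<open>V\<close>, and they are killed by all contractions.
\<close>

lemma tensor_power_geometric_module:
  "tensor_power (geometric_module n) d = {f \<in> nc_homogeneous n d. \<forall>i<d. contract i f = 0}"
proof (intro equalityI subsetI)
  fix f assume f: "f \<in> tensor_power (geometric_module n) d"
  then have h: "f \<in> nc_homogeneous n d" using tensor_power_homogeneous by blast
  have "contract i f = 0" if "i < d" for i
  proof -
    have "contract i f = contract i (free_subst (\<lambda>i. gen i - gen n) f)"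
      using f tensor_power_fixed by force
    also have "\<dots> = lin_ext (\<lambda>w. contract i (prod_list (map (\<lambda>i. gen i - gen n) w))) f"
      by (simp add: contract_def free_subst_lin_ext lin_ext_comp)
    also have "\<dots> = lin_ext (\<lambda>w. 0) f"
      by (rule lin_ext_cong)
         (use h that contract_shifted_word in \<open>auto simp: nc_homogeneous_iff words_over_def\<close>)
    finally show ?thesis by simp
  qed
  with h show "f \<in> {f \<in> nc_homogeneous n d. \<forall>i<d. contract i f = 0}" by blast
next
  fix f assume "f \<in> {f \<in> nc_homogeneous n d. \<forall>i<d. contract i f = 0}"
  then show "f \<in> tensor_power (geometric_module n) d"
    using shift_fixes_contraction_kernel[of f n d n] free_subst_shift_in_tensor_power[of f n d] by simp
qed

corollary invariants_tensor_power:
  "invariants n diagonal_action (tensor_power (geometric_module n) d) = partial_invariants n d d"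
  by (auto simp: tensor_power_geometric_module partial_invariants_def invariants_def)

section \<open>Non-commutative polynomials as tensors\<close>

lemma free_subst_diff: "free_subst h (f - g) = free_subst h f - free_subst h g"
  by (simp add: free_subst_lin_ext)

lemma nc_to_tensor_y_diff: "nc_to_tensor (y_diff a b) = gen a - gen b"
proof -
  have tele: "nc_to_tensor (\<Sum>j\<in>{a..<b}. gen j) = gen a - gen b" if "a \<le> b" for a b
  proof -
    have "nc_to_tensor (\<Sum>j\<in>{a..<b}. gen j) = (\<Sum>j\<in>{a..<b}. gen j - gen (Suc j))"
      by (simp add: nc_to_tensor_def free_subst_lin_ext) (simp add: gen_def)
    also have "\<dots> = gen a - gen b"
      using sum_Suc_diff'[OF that, of gen] by (simp add: sum_subtractf algebra_simps)
    finally show ?thesis .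
  qed
  have "nc_to_tensor (y_diff a b) = nc_to_tensor (\<Sum>j\<in>{a..<b}. gen j) - nc_to_tensor (\<Sum>j\<in>{b..<a}. gen j)"
    by (simp add: y_diff_def nc_to_tensor_def free_subst_diff)
  then show ?thesis
    using tele[of a b] tele[of b a]
    by (cases "a \<le> b") (auto simp: nc_to_tensor_def free_subst_lin_ext)
qed

lemma y_diff_homogeneous:
  assumes "a \<in> {1..n}" "b \<in> {1..n}"
  shows "y_diff a b \<in> nc_homogeneous (n - 1) 1"
  unfolding y_diff_def using assms
  by (intro fa.subspace_diff fa.subspace_sum subspace_nc_homogeneous gen_in_nc_homogeneous) auto

lemma y_diff_consecutive: "i < n \<Longrightarrow> y_diff i n - y_diff (i + 1) n = gen i"
  by (simp add: y_diff_def sum.atLeast_Suc_lessThan)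

text \<open>
  The inverse of the identification writes each \<open>x\<^sub>a - x\<^sub>n\<close> in terms of the \<open>y\<^sub>i\<close>; it is defined on all
  tensors, but it inverts the identification only on the tensor power of the geometric module,
  where replacing \<open>x\<^sub>a\<close> by \<open>x\<^sub>a - x\<^sub>n\<close> has no effect.
\<close>

definition tensor_to_nc :: "nat \<Rightarrow> free_alg \<Rightarrow> free_alg" where
  "tensor_to_nc n = free_subst (\<lambda>i. y_diff i n)"

lemma tensor_to_nc_to_tensor:
  assumes "f \<in> tensor_power (geometric_module n) d"
  shows "nc_to_tensor (tensor_to_nc n f) = f"
proof -
  have "nc_to_tensor (tensor_to_nc n f) = free_subst (\<lambda>i. nc_to_tensor (y_diff i n)) f"
    by (simp add: nc_to_tensor_def tensor_to_nc_def free_subst_comp)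
  then show ?thesis using tensor_power_fixed assms by (force simp: nc_to_tensor_y_diff)
qed

lemma nc_to_tensor_to_nc:
  assumes "f \<in> nc_homogeneous (n - 1) d"
  shows "tensor_to_nc n (nc_to_tensor f) = f"
proof -
  have "tensor_to_nc n (nc_to_tensor f) = free_subst (\<lambda>i. y_diff i n - y_diff (i + 1) n) f"
    by (simp add: nc_to_tensor_def tensor_to_nc_def free_subst_comp free_subst_diff)
  also have "\<dots> = free_subst gen f"
    by (rule free_subst_cong, rule y_diff_consecutive)
       (use assms in \<open>force simp: nc_homogeneous_def\<close>)
  finally show ?thesis by (simp add: free_subst_id)
qed

lemma nc_to_tensor_in_tensor_power:
  assumes "f \<in> nc_homogeneous (n - 1) d"
  shows "nc_to_tensor f \<in> tensor_power (geometric_module n) d"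
  unfolding nc_to_tensor_def
  by (rule free_subst_in_tensor_power[OF assms]) (auto simp: geometric_module_def intro: fa.span_base)

lemma tensor_to_nc_homogeneous:
  assumes "f \<in> nc_homogeneous n d" "n \<ge> 1"
  shows "tensor_to_nc n f \<in> nc_homogeneous (n - 1) d"
  unfolding tensor_to_nc_def
  by (rule nc_homogeneous_free_subst[OF assms(1)], rule y_diff_homogeneous) (use assms(2) in auto)

lemma nc_action_homogeneous:
  assumes "f \<in> nc_homogeneous (n - 1) d" "\<sigma> permutes {1..n}"
  shows "nc_action \<sigma> f \<in> nc_homogeneous (n - 1) d"
  unfolding nc_action_def
proof (rule nc_homogeneous_free_subst[OF assms(1)], rule y_diff_homogeneous)
  fix i assume "i \<in> {1..n - 1}"
  then have "i \<in> {1..n}" "i + 1 \<in> {1..n}" by auto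
  then show "\<sigma> i \<in> {1..n}" "\<sigma> (i + 1) \<in> {1..n}"
    by (simp_all only: permutes_in_image[OF assms(2)])
qed

lemma nc_to_tensor_equivariant: "nc_to_tensor (nc_action \<sigma> f) = diagonal_action \<sigma> (nc_to_tensor f)"
proof -
  have "nc_to_tensor (nc_action \<sigma> f) = free_subst (\<lambda>i. nc_to_tensor (y_diff (\<sigma> i) (\<sigma> (i + 1)))) f"
    by (simp add: nc_to_tensor_def nc_action_def free_subst_comp)
  also have "\<dots> = diagonal_action \<sigma> (nc_to_tensor f)"
    unfolding nc_to_tensor_y_diff
    by (simp add: nc_to_tensor_def diagonal_action_def free_subst_comp free_subst_diff)
  finally show ?thesis .
qed

lemma linear_nc_to_tensor: "Vector_Spaces.linear scale scale nc_to_tensor"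
  unfolding nc_to_tensor_def free_subst_lin_ext by (rule linear_lin_ext)

lemma bij_betw_nc_to_tensor_invariants:
  assumes "n \<ge> 1"
  shows "bij_betw nc_to_tensor
           (invariants n nc_action (nc_homogeneous (n - 1) d))
           (invariants n diagonal_action (tensor_power (geometric_module n) d))"
proof (rule bij_betw_byWitness[where f' = "tensor_to_nc n"])
  show "\<forall>f\<in>invariants n nc_action (nc_homogeneous (n - 1) d). tensor_to_nc n (nc_to_tensor f) = f"
    by (auto simp: invariants_def nc_to_tensor_to_nc)
  show "\<forall>f\<in>invariants n diagonal_action (tensor_power (geometric_module n) d).
          nc_to_tensor (tensor_to_nc n f) = f"
    by (auto simp: invariants_def tensor_to_nc_to_tensor)
  show "nc_to_tensor ` invariants n nc_action (nc_homogeneous (n - 1) d)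
          \<subseteq> invariants n diagonal_action (tensor_power (geometric_module n) d)"
    by (auto simp: invariants_def nc_to_tensor_in_tensor_power simp flip: nc_to_tensor_equivariant)
  show "tensor_to_nc n ` invariants n diagonal_action (tensor_power (geometric_module n) d)
          \<subseteq> invariants n nc_action (nc_homogeneous (n - 1) d)"
  proof safe
    fix f assume f: "f \<in> invariants n diagonal_action (tensor_power (geometric_module n) d)"
    then have t: "f \<in> tensor_power (geometric_module n) d" by (simp add: invariants_def)
    let ?g = "tensor_to_nc n f"
    have g: "?g \<in> nc_homogeneous (n - 1) d"
      using t tensor_power_homogeneous tensor_to_nc_homogeneous assms by blast
    have "nc_action \<sigma> ?g = ?g" if \<sigma>: "\<sigma> \<in> carrier (sym_group n)" for \<sigma>
    proof -
      have "nc_to_tensor (nc_action \<sigma> ?g) = diagonal_action \<sigma> f"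
        by (simp add: nc_to_tensor_equivariant tensor_to_nc_to_tensor[OF t])
      also have "\<dots> = f" using f \<sigma> by (simp add: invariants_def)
      finally have "tensor_to_nc n (nc_to_tensor (nc_action \<sigma> ?g)) = ?g" by simp
      then show ?thesis
        using nc_to_tensor_to_nc[OF nc_action_homogeneous[OF g]] \<sigma> by (simp add: sym_group_carrier)
    qed
    with g show "?g \<in> invariants n nc_action (nc_homogeneous (n - 1) d)"
      by (simp add: invariants_def)
  qed
qed

lemma dim_nc_invariants:
  assumes "n \<ge> 1"
  shows "fa.dim (invariants n nc_action (nc_homogeneous (n - 1) d)) =
         fa.dim (invariants n diagonal_action (tensor_power (geometric_module n) d))"
proof -
  let ?U = "invariants n nc_action (nc_homogeneous (n - 1) d)"
  have U: "fa.subspace ?U"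
    using subspace_nc_homogeneous[of "n - 1" d]
    by (auto simp: fa.subspace_def invariants_def nc_action_def free_subst_lin_ext)
  have bij: "bij_betw nc_to_tensor ?U (invariants n diagonal_action (tensor_power (geometric_module n) d))"
    by (rule bij_betw_nc_to_tensor_invariants[OF assms])
  have z: "nc_to_tensor 0 = 0" by (simp add: nc_to_tensor_def free_subst_lin_ext)
  have "{f \<in> ?U. nc_to_tensor f = 0} \<subseteq> {0}"
    using inj_onD[OF bij_betw_imp_inj_on[OF bij], of _ 0] fa.subspace_0[OF U] z by force
  then have "fa.dim {f \<in> ?U. nc_to_tensor f = 0} = 0"
    using fa.dim_le_card[of _ "{}"] by (fastforce simp: fa.span_empty)
  then show ?thesis
    using rank_nullity_homogeneous[OF linear_nc_to_tensor U, of "n - 1" d] bij_betw_imp_surj_on[OF bij]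
    by (simp add: invariants_def)
qed

section \<open>Words with a prefix avoiding the identity\<close>

lemma nth_ins_nth: "i < j \<Longrightarrow> j \<le> length w \<Longrightarrow> ins_nth j a w ! i = w ! i"
proof (induction j a w arbitrary: i rule: ins_nth.induct)
  case (3 j a b w)
  then show ?case by (cases i) auto
qed auto

lemma ins_nth_same: "j \<le> length w \<Longrightarrow> ins_nth j a w ! j = a"
  by (induction j a w rule: ins_nth.induct) auto

lemma ins_del: "j < length w \<Longrightarrow> ins_nth j (w ! j) (del_nth j w) = w"
  by (induction j w rule: del_nth.induct) auto

text \<open>
  The neutral element is adjoined to the generators, but the first \<open>j\<close> letters of a word must not be
  equal to it. For \<open>j = d\<close> it does not occur at all.
\<close>

definition partial_words :: "('a, 'b) monoid_scheme \<Rightarrow> 'a set \<Rightarrow> nat \<Rightarrow> nat \<Rightarrow> 'a \<Rightarrow> 'a list set" where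
  "partial_words G S j d g =
     {ws \<in> words_reducing_to G (insert (one G) S) d g. \<forall>i<j. ws ! i \<noteq> one G}"

lemma partial_words_0: "partial_words G S 0 d g = words_reducing_to G (insert (one G) S) d g"
  by (simp add: partial_words_def)

lemma partial_words_full:
  assumes "one G \<notin> S"
  shows "partial_words G S d d g = words_reducing_to G S d g"
  using assms by (fastforce simp: partial_words_def words_reducing_to_def in_set_conv_nth subset_iff)

lemma finite_words_reducing_to: "finite S \<Longrightarrow> finite (words_reducing_to G S d g)"
  by (rule finite_subset[OF _ finite_lists_length_eq[of S d]]) (auto simp: words_reducing_to_def)

lemma (in monoid) foldr_mult_closed: "set ws \<subseteq> carrier G \<Longrightarrow> foldr (\<otimes>) ws \<one> \<in> carrier G"
  by (induction ws) auto

lemma (in monoid) foldr_mult_ins_one: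
  "set ws \<subseteq> carrier G \<Longrightarrow> foldr (\<otimes>) (ins_nth j \<one> ws) \<one> = foldr (\<otimes>) ws \<one>"
  by (induction j "\<one>" ws rule: ins_nth.induct) (auto simp: foldr_mult_closed)

text \<open>
  The words whose letter at position \<open>j\<close> is neutral correspond, by deleting this letter, to the
  words of length one less.
\<close>

lemma (in monoid) card_partial_words_step:
  assumes S: "S \<subseteq> carrier G" "finite S" and j: "j \<le> d"
  shows "card (partial_words G S j (Suc d) g) =
         card (partial_words G S (Suc j) (Suc d) g) + card (partial_words G S j d g)"
proof -
  let ?P = "partial_words G S"
  let ?I = "ins_nth j \<one> ` ?P j d g"
  have len: "ws \<in> ?P j d g \<Longrightarrow> length ws = d" for ws
    by (simp add: partial_words_def words_reducing_to_def)
  have "ws \<in> ?I" if ws: "ws \<in> ?P j (Suc d) g" "ws ! j = \<one>" for ws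
  proof (rule image_eqI)
    have l: "length ws = Suc d" using ws(1) by (simp add: partial_words_def words_reducing_to_def)
    then show eq: "ws = ins_nth j \<one> (del_nth j ws)"
      using ins_del[of j ws] j ws(2) by simp
    have l': "length (del_nth j ws) = d" using l j by (simp add: length_del_nth)
    have s: "set (del_nth j ws) \<subseteq> insert \<one> S"
      using ws(1) set_del_nth[of j ws] by (auto simp: partial_words_def words_reducing_to_def)
    have "foldr (\<otimes>) (del_nth j ws) \<one> = foldr (\<otimes>) ws \<one>"
    proof -
      have "set (del_nth j ws) \<subseteq> carrier G" using s S(1) one_closed by blast
      then show ?thesis using foldr_mult_ins_one eq by metis
    qed
    moreover have "\<forall>i<j. del_nth j ws ! i \<noteq> \<one>"
      using ws(1) nth_ins_nth[of _ j "del_nth j ws" \<one>] l' j eq by (auto simp: partial_words_def)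
    ultimately show "del_nth j ws \<in> ?P j d g"
      using ws(1) l' s by (simp add: partial_words_def words_reducing_to_def)
  qed
  moreover have "ins_nth j \<one> ws \<in> ?P j (Suc d) g" if "ws \<in> ?P j d g" for ws
    using that j foldr_mult_ins_one[of ws j] S(1)
    by (auto simp: partial_words_def words_reducing_to_def nth_ins_nth)
  ultimately have split: "?P j (Suc d) g = ?P (Suc j) (Suc d) g \<union> ?I"
    by (auto simp: partial_words_def less_Suc_eq)
  have "?P (Suc j) (Suc d) g \<inter> ?I = {}"
    using len j by (auto simp: partial_words_def ins_nth_same)
  moreover have "finite (?P j (Suc d) g)"
    using finite_words_reducing_to[of "insert \<one> S" G "Suc d" g] S(2) by (simp add: partial_words_def)
  moreover have "card ?I = card (?P j d g)"
  proof (rule card_image, rule inj_on_inverseI)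
    fix ws assume "ws \<in> ?P j d g"
    then show "del_nth j (ins_nth j \<one> ws) = ws" using len j by (simp add: del_ins_same)
  qed
  ultimately show ?thesis using split by (simp add: card_Un_disjoint)
qed

section \<open>Words in the cycles as shuffles of a deck\<close>

text \<open>
  The first entry \<open>x\<close> of the cycle is kept arbitrary because the recursion for \<open>cycle_of_list\<close>
  replaces it with the next entry.
\<close>

lemma cycle_of_list_rev_upt:
  assumes "k \<ge> 2" "x \<notin> {2..k}"
  shows "cycle_of_list (x # rev [2..<k + 1]) y =
         (if y = x then k else if y = 2 then x else if 2 < y \<and> y \<le> k then y - 1 else y)"
  using assms
proof (induction k arbitrary: x y rule: nat_induct_at_least)
  case base
  then show ?case by (auto simp: transpose_def upt_rec)
next
  case (Suc k)
  have "cycle_of_list (x # rev [2..<Suc k + 1]) y =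
        transpose x (Suc k) (cycle_of_list (Suc k # rev [2..<k + 1]) y)"
    using Suc.hyps by simp
  also have "cycle_of_list (Suc k # rev [2..<k + 1]) y =
      (if y = Suc k then k else if y = 2 then Suc k else if 2 < y \<and> y \<le> k then y - 1 else y)"
    by (rule Suc.IH) simp
  also have "transpose x (Suc k) \<dots> =
      (if y = x then Suc k else if y = 2 then x else if 2 < y \<and> y \<le> Suc k then y - 1 else y)"
  proof -
    have x: "x < 2 \<or> Suc k < x" using Suc.prems by auto
    consider "y = x" | "y = Suc k" | "y = 2" | "2 < y" "y \<le> k"
      | "y \<noteq> x" "y \<noteq> Suc k" "y \<noteq> 2" "y < 2 \<or> Suc k < y"
      by linarith
    then show ?thesis
    proof cases
      case 4
      then have "y - 1 \<noteq> x" "y - 1 \<noteq> Suc k" "y \<noteq> x" using x by linarith+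
      then show ?thesis using 4 by simp
    qed (use x Suc.hyps in auto)
  qed
  finally show ?case .
qed

lemma down_cycle_apply:
  assumes "k \<ge> 1"
  shows "down_cycle k y = (if y = 1 then k else if 2 \<le> y \<and> y \<le> k then y - 1 else y)"
proof (cases "k = 1")
  case True
  then show ?thesis by (auto simp: down_cycle_def)
next
  case False
  then show ?thesis
    unfolding down_cycle_def using cycle_of_list_rev_upt[of k 1 y] assms by auto
qed

lemma down_cycle_permutes:
  assumes "k \<in> {1..n}"
  shows "down_cycle k permutes {1..n}"
  unfolding down_cycle_def
  by (rule permutes_subset[OF cycle_permutes]) (use assms in auto)

text \<open>
  A permutation is a deck which has the card \<open>g i\<close> at position \<open>i\<close>. Multiplying it on the right
  by the \<open>k\<close>-th cycle moves the card at position \<open>k\<close> to the top.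
\<close>

lemma map_down_cycle:
  assumes "k \<in> {1..n}"
  shows "map (down_cycle k) [1..<Suc n] = k # filter (\<lambda>x. x \<noteq> k) [1..<Suc n]"
proof -
  have split: "[1..<Suc n] = [1..<Suc k] @ [Suc k..<Suc n]"
    using assms upt_add_eq_append[of 1 "Suc k" "n - k"] by (simp del: upt_Suc)
  have "[1..<Suc k] = 1 # map Suc [1..<k]"
    using assms by (simp add: map_Suc_upt upt_conv_Cons numeral_2_eq_2 del: upt_Suc)
  with split have A: "[1..<Suc n] = 1 # map Suc [1..<k] @ [Suc k..<Suc n]" by simp
  have B: "[1..<Suc n] = [1..<k] @ k # [Suc k..<Suc n]"
    using split assms by simp
  have "map (down_cycle k) [1..<Suc n] = k # [1..<k] @ [Suc k..<Suc n]"
    unfolding A using assms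
    by (auto simp: down_cycle_apply intro!: map_idI simp del: upt_Suc)
  moreover have "filter (\<lambda>x. x \<noteq> k) [1..<Suc n] = [1..<k] @ [Suc k..<Suc n]"
    unfolding B by (simp del: upt_Suc)
  ultimately show ?thesis by simp
qed

text \<open>
  The labels of the cards which the word moves to the top, starting from the deck \<open>g\<close>.
\<close>

fun labels :: "(nat \<Rightarrow> nat) \<Rightarrow> (nat \<Rightarrow> nat) list \<Rightarrow> nat list" where
  "labels g [] = []"
| "labels g (s # ws) = g (s 1) # labels (g \<circ> s) ws"

lemma deck_after_labels:
  assumes "set ws \<subseteq> down_cycle ` {1..n}" "inj g"
  shows "map (g \<circ> foldr (\<circ>) ws id) [1..<Suc n] =
         rev (remdups (labels g ws)) @ filter (\<lambda>x. x \<notin> set (labels g ws)) (map g [1..<Suc n])"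
  using assms
proof (induction ws arbitrary: g)
  case Nil
  then show ?case by simp
next
  case (Cons s ws)
  then obtain k where k: "k \<in> {1..n}" "s = down_cycle k" by auto
  have inj: "inj (g \<circ> s)"
    using Cons.prems(2) down_cycle_permutes[OF k(1)] k(2) by (simp add: inj_compose permutes_inj)
  have "map (g \<circ> s) [1..<Suc n] = map g (map (down_cycle k) [1..<Suc n])"
    using k(2) by (simp del: upt_Suc)
  also have "\<dots> = g k # filter (\<lambda>x. x \<noteq> g k) (map g [1..<Suc n])"
    unfolding map_down_cycle[OF k(1)] using Cons.prems(2)
    by (simp add: filter_map o_def inj_eq del: upt_Suc)
  finally have deck: "map (g \<circ> s) [1..<Suc n] = g k # filter (\<lambda>x. x \<noteq> g k) (map g [1..<Suc n])" .
  have labels: "labels g (s # ws) = g k # labels (g \<circ> s) ws"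
    using k by (simp add: down_cycle_apply)
  have "map (g \<circ> foldr (\<circ>) (s # ws) id) [1..<Suc n] = map ((g \<circ> s) \<circ> foldr (\<circ>) ws id) [1..<Suc n]"
    by (simp only: foldr_Cons o_apply comp_assoc)
  also have "\<dots> = rev (remdups (labels (g \<circ> s) ws)) @
     filter (\<lambda>x. x \<notin> set (labels (g \<circ> s) ws)) (g k # filter (\<lambda>x. x \<noteq> g k) (map g [1..<Suc n]))"
    unfolding deck[symmetric] by (rule Cons.IH[OF _ inj]) (use Cons.prems(1) in simp)
  also have "\<dots> = rev (remdups (labels g (s # ws))) @
     filter (\<lambda>x. x \<notin> set (labels g (s # ws))) (map g [1..<Suc n])"
    unfolding labels by (simp add: conj_commute del: upt_Suc)
  finally show ?case .
qed

text \<open>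
  The label of the moved card determines its position in the current deck, and hence the letter.
\<close>

lemma labels_inj:
  assumes "length ws = length ws'" "set ws \<subseteq> down_cycle ` {1..n}" "set ws' \<subseteq> down_cycle ` {1..n}"
    "inj g" "labels g ws = labels g ws'"
  shows "ws = ws'"
  using assms
proof (induction ws ws' arbitrary: g rule: list_induct2)
  case (Cons s ws s' ws')
  obtain k k' where k: "k \<in> {1..n}" "s = down_cycle k" "k' \<in> {1..n}" "s' = down_cycle k'"
    using Cons.prems by auto
  have "s 1 = s' 1" using Cons.prems by (simp add: inj_eq)
  then have "s = s'" using k by (simp add: down_cycle_apply)
  have inj: "inj (g \<circ> s)"
    using Cons.prems(3) down_cycle_permutes[OF k(1)] k(2) by (simp add: inj_compose permutes_inj)
  have eq: "labels (g \<circ> s) ws = labels (g \<circ> s) ws'"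
    using Cons.prems(4) \<open>s = s'\<close> by simp
  have "ws = ws'"
    by (rule Cons.IH[OF _ _ inj eq]) (use Cons.prems(1,2) in simp_all)
  with \<open>s = s'\<close> show ?case by simp
qed simp

lemma labels_surj:
  assumes "set L \<subseteq> {1..n}" "g permutes {1..n}"
  shows "\<exists>ws. length ws = length L \<and> set ws \<subseteq> down_cycle ` {1..n} \<and> labels g ws = L"
  using assms
proof (induction L arbitrary: g)
  case (Cons a L)
  define k where "k = inv_into UNIV g a"
  have k: "k \<in> {1..n}" "g k = a"
    using Cons.prems permutes_inverses(1)[OF Cons.prems(2), of a]
      permutes_in_image[OF permutes_inv[OF Cons.prems(2)], of a]
    by (simp_all add: k_def)
  have "g \<circ> down_cycle k permutes {1..n}"
    by (rule permutes_compose[OF down_cycle_permutes[OF k(1)] Cons.prems(2)])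
  moreover have "set L \<subseteq> {1..n}" using Cons.prems(1) by simp
  ultimately obtain ws where "length ws = length L" "set ws \<subseteq> down_cycle ` {1..n}"
      "labels (g \<circ> down_cycle k) ws = L"
    using Cons.IH by blast
  then show ?case
    using k down_cycle_apply[of k 1] by (intro exI[of _ "down_cycle k # ws"]) auto
qed simp

lemma labels_in_words_over:
  "set ws \<subseteq> down_cycle ` {1..n} \<Longrightarrow> g permutes {1..n} \<Longrightarrow> labels g ws \<in> words_over n (length ws)"
proof (induction ws arbitrary: g)
  case Nil
  show ?case by (simp add: words_over_def)
next
  case (Cons s ws)
  then obtain k where k: "k \<in> {1..n}" "s = down_cycle k" by auto
  have "g k \<in> {1..n}" using k(1) permutes_in_image[OF Cons.prems(2)] by blast
  moreover have "g \<circ> s permutes {1..n}"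
    using permutes_compose[OF down_cycle_permutes[OF k(1)] Cons.prems(2)] k(2) by simp
  ultimately show ?case using Cons k by (auto simp: words_over_def down_cycle_apply)
qed

text \<open>
  The label sequences which restore the sorted deck. Since \<^const>\<open>remdups\<close> keeps last occurrences,
  \<open>rev (remdups w)\<close> lists the moved cards from the most recently moved one on.
\<close>

definition canonical_words :: "nat \<Rightarrow> nat \<Rightarrow> nat list set" where
  "canonical_words n d =
     {w \<in> words_over n d. rev (remdups w) @ filter (\<lambda>x. x \<notin> set w) [1..<Suc n] = [1..<Suc n]}"

lemma foldr_comp_permutes:
  "set ws \<subseteq> down_cycle ` {1..n} \<Longrightarrow> foldr (\<circ>) ws id permutes {1..n}"
  by (induction ws) (auto intro!: permutes_compose down_cycle_permutes permutes_id simp del: One_nat_def)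

lemma insert_one_cycle_generators:
  assumes "n \<ge> 1"
  shows "insert (one (sym_group n)) (cycle_generators n) = down_cycle ` {1..n}"
proof -
  have "down_cycle 1 = id" by (simp add: down_cycle_def)
  moreover have "{1..n} = insert 1 {2..n}" using assms by auto
  ultimately show ?thesis by (simp add: cycle_generators_def sym_group_one)
qed

lemma one_notin_cycle_generators: "one (sym_group n) \<notin> cycle_generators n"
proof
  assume "one (sym_group n) \<in> cycle_generators n"
  then obtain k where "k \<ge> 2" "down_cycle k = id"
    by (auto simp: cycle_generators_def sym_group_one)
  then show False using down_cycle_apply[of k 1] by simp
qed

lemma card_words_with_identity:
  assumes "n \<ge> 1"
  shows "card (words_reducing_to (sym_group n)
           (insert (one (sym_group n)) (cycle_generators n)) d (one (sym_group n))) =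
         card (canonical_words n d)"
proof (rule bij_betw_same_card[of "labels id"])
  let ?W = "words_reducing_to (sym_group n) (down_cycle ` {1..n}) d id"
  have iff: "foldr (\<circ>) ws id = id \<longleftrightarrow> labels id ws \<in> canonical_words n (length ws)"
    if ws: "set ws \<subseteq> down_cycle ` {1..n}" for ws
  proof -
    have "map (foldr (\<circ>) ws id) [1..<Suc n] =
        rev (remdups (labels id ws)) @ filter (\<lambda>x. x \<notin> set (labels id ws)) [1..<Suc n]"
      using deck_after_labels[OF ws, of id] by (simp del: upt_Suc)
    then have "labels id ws \<in> canonical_words n (length ws) \<longleftrightarrow>
        map (foldr (\<circ>) ws id) [1..<Suc n] = [1..<Suc n]"
      using labels_in_words_over[OF ws permutes_id] by (simp add: canonical_words_def del: upt_Suc)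
    also have "\<dots> \<longleftrightarrow> (\<forall>x\<in>{1..n}. foldr (\<circ>) ws id x = x)"
      using map_eq_conv[of "foldr (\<circ>) ws id" "[1..<Suc n]" id]
      by (simp add: atLeastLessThanSuc_atLeastAtMost del: upt_Suc map_eq_conv)
    also have "\<dots> \<longleftrightarrow> foldr (\<circ>) ws id = id"
      using foldr_comp_permutes[OF ws] by (auto simp: fun_eq_iff permutes_def)
    finally show ?thesis by simp
  qed
  have "bij_betw (labels id) ?W (canonical_words n d)"
  proof (rule bij_betwI')
    fix ws ws' assume "ws \<in> ?W" "ws' \<in> ?W"
    then show "labels id ws = labels id ws' \<longleftrightarrow> ws = ws'"
      using labels_inj[of ws ws' n id] by (auto simp: words_reducing_to_def)
  next
    fix ws assume "ws \<in> ?W"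
    then show "labels id ws \<in> canonical_words n d"
      using iff[of ws] by (auto simp: words_reducing_to_def sym_group_mult sym_group_one)
  next
    fix L assume L: "L \<in> canonical_words n d"
    then obtain ws where "length ws = d" "set ws \<subseteq> down_cycle ` {1..n}" "labels id ws = L"
      using labels_surj[of L n id] permutes_id by (auto simp: canonical_words_def words_over_def)
    then show "\<exists>ws\<in>?W. L = labels id ws"
      using iff[of ws] L by (auto simp: words_reducing_to_def sym_group_mult sym_group_one)
  qed
  then show "bij_betw (labels id) (words_reducing_to (sym_group n)
           (insert (one (sym_group n)) (cycle_generators n)) d (one (sym_group n))) (canonical_words n d)"
    by (simp only: insert_one_cycle_generators[OF assms, unfolded sym_group_one] sym_group_one)
qed

section \<open>Canonical representatives of the orbits of words\<close>

lemma exists_permutation_between_lists: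
  assumes "distinct xs" "distinct ys" "set xs = A" "set ys = A"
  shows "\<exists>\<sigma>. \<sigma> permutes A \<and> map \<sigma> xs = ys"
proof -
  have len: "length xs = length ys" using assms distinct_card by metis
  have bx: "bij_betw ((!) xs) {..<length xs} A" and bY: "bij_betw ((!) ys) {..<length xs} A"
    using bij_betw_nth[OF assms(1) refl assms(3)[symmetric]] bij_betw_nth[OF assms(2) refl assms(4)[symmetric]] len
    by auto
  let ?r = "the_inv_into {..<length xs} ((!) xs)"
  define \<sigma> where "\<sigma> x = (if x \<in> A then ys ! ?r x else x)" for x
  have "bij_betw ((!) ys \<circ> ?r) A A"
    by (rule bij_betw_trans[OF bij_betw_the_inv_into[OF bx] bY])
  then have "bij_betw \<sigma> A A"
    by (rule bij_betw_cong[THEN iffD1, rotated]) (simp add: \<sigma>_def)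
  then have "\<sigma> permutes A" by (rule bij_imp_permutes) (simp add: \<sigma>_def)
  moreover have "map \<sigma> xs = ys"
    using len assms(3) the_inv_into_f_f[OF bij_betw_imp_inj_on[OF bx]]
    by (auto simp: \<sigma>_def intro!: nth_equalityI)
  ultimately show ?thesis by blast
qed

lemma remdups_map_inj: "inj \<sigma> \<Longrightarrow> remdups (map \<sigma> w) = map \<sigma> (remdups w)"
  by (induction w) (auto simp: inj_image_mem_iff)

text \<open>
  Start from the deck that lists the moved cards as they will lie in the end, followed by the
  other cards: the moves \<open>w\<close> restore it. Relabelling its cards by \<open>1, \<dots>, n\<close> in order makes \<open>w\<close>
  canonical.
\<close>

lemma canonical_word_exists:
  assumes "w \<in> words_over n d"
  shows "\<exists>\<sigma>. \<sigma> permutes {1..n} \<and> map \<sigma> w \<in> canonical_words n d"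
proof -
  let ?D = "rev (remdups w) @ filter (\<lambda>x. x \<notin> set w) [1..<Suc n]"
  have "set ?D = {1..n}" "distinct ?D"
    using assms by (auto simp: words_over_def simp del: upt_Suc)
  then have "\<exists>\<sigma>. \<sigma> permutes {1..n} \<and> map \<sigma> ?D = [1..<Suc n]"
    by (intro exists_permutation_between_lists) (auto simp del: upt_Suc)
  then obtain \<sigma> where \<sigma>: "\<sigma> permutes {1..n}" "map \<sigma> ?D = [1..<Suc n]" by blast
  define Y where "Y = map \<sigma> (filter (\<lambda>x. x \<notin> set w) [1..<Suc n])"
  let ?R = "rev (remdups (map \<sigma> w))"
  \<comment> \<open>\<open>?R\<close> lists the moved cards of the relabelled sequence, and \<open>Y\<close> will be its unmoved cards.\<close>
  have split: "?R @ Y = [1..<Suc n]"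
    using \<sigma>(2) remdups_map_inj[OF permutes_inj[OF \<sigma>(1)], of w] by (simp add: Y_def rev_map del: upt_Suc)
  then have "distinct (?R @ Y)" by (simp only: distinct_upt)
  then have dis: "set (map \<sigma> w) \<inter> set Y = {}" by simp
  have "filter (\<lambda>x. x \<notin> set (map \<sigma> w)) (?R @ Y) = Y"
    using dis by (auto simp: filter_id_conv filter_empty_conv)
  then have "?R @ filter (\<lambda>x. x \<notin> set (map \<sigma> w)) [1..<Suc n] = [1..<Suc n]"
    using split by simp
  moreover have "map \<sigma> w \<in> words_over n d"
    by (rule map_permutes_words_over[OF assms \<sigma>(1)])
  ultimately show ?thesis using \<sigma>(1) by (auto simp: canonical_words_def simp del: upt_Suc)
qed

text \<open>
  The distinct letters of a canonical word, ordered by last occurrence (latest first), form an initial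
  segment of
  \<open>1, \<dots>, n\<close>. A relabelling preserves the number of distinct letters, so it maps this segment to
  itself in order and fixes every letter that occurs.
\<close>

lemma canonical_word_unique:
  assumes "w \<in> canonical_words n d" "map \<sigma> w \<in> canonical_words n d" "inj \<sigma>"
  shows "map \<sigma> w = w"
proof -
  have "rev (remdups w) @ filter (\<lambda>x. x \<notin> set w) [1..<Suc n] =
     rev (map \<sigma> (remdups w)) @ filter (\<lambda>x. x \<notin> set (map \<sigma> w)) [1..<Suc n]"
    using assms remdups_map_inj[OF assms(3), of w] by (simp add: canonical_words_def del: upt_Suc)
  \<comment> \<open>Both sides are the same list, and the first parts have equal length.\<close>
  then have "remdups w = map \<sigma> (remdups w)"
    by (subst (asm) append_eq_append_conv) (auto simp del: upt_Suc)
  then have "map \<sigma> (remdups w) = map id (remdups w)" by simp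
  then have "\<sigma> x = x" if "x \<in> set w" for x
    using that by (simp only: map_eq_conv set_remdups id_apply)
  then show ?thesis by (simp add: map_idI)
qed

section \<open>The dimension count\<close>

lemma independent_words: "fa.independent ((\<lambda>w. Poly_Mapping.single w 1) ` A)" if "finite A"
proof (rule fa.independent_if_scalars_zero)
  let ?s = "\<lambda>w. Poly_Mapping.single w 1 :: free_alg"
  show "finite (?s ` A)" using that by simp
  fix c x assume z: "(\<Sum>x\<in>?s ` A. scale (c x) x) = 0" and "x \<in> ?s ` A"
  then obtain v where v: "v \<in> A" "x = ?s v" by blast
  have inj: "inj_on ?s A" by (auto intro!: inj_onI dest: arg_cong[of _ _ Poly_Mapping.keys])
  have "0 = Poly_Mapping.lookup (\<Sum>w\<in>A. scale (c (?s w)) (?s w)) v"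
    using z by (simp add: sum.reindex[OF inj])
  also have "\<dots> = (\<Sum>w\<in>A. if v = w then c (?s w) else 0)"
    unfolding lookup_sum lookup_scale by (rule sum.cong) (auto simp: lookup_single when_def)
  also have "\<dots> = c x" using v that by simp
  finally show "c x = 0" by simp
qed

lemma lookup_relabelled:
  assumes "inj \<sigma>"
  shows "Poly_Mapping.lookup (diagonal_action \<sigma> f) (map \<sigma> w) = Poly_Mapping.lookup f w"
proof -
  have "Poly_Mapping.lookup (diagonal_action \<sigma> f) (map \<sigma> w) =
        (\<Sum>v\<in>Poly_Mapping.keys f. if w = v then Poly_Mapping.lookup f v else 0)"
    unfolding diagonal_action_lin_ext lin_ext_def lookup_sum lookup_scale
    by (rule sum.cong) (auto simp: lookup_single when_def inj_map_eq_map[OF assms])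
  then show ?thesis by (simp add: in_keys_iff)
qed

text \<open>
  The restriction of coefficients to canonical words is an isomorphism from the invariants to the
  span of the canonical words. It is injective because an invariant tensor has equal coefficients at all
  words of an orbit, and every orbit contains a canonical word; the sum over the orbit of a
  canonical word is a preimage of this word, because no other word of the orbit is canonical.
\<close>

lemma dim_permutation_invariants:
  "fa.dim (partial_invariants n 0 d) = card (canonical_words n d)"
proof -
  let ?U = "partial_invariants n 0 d" and ?C = "canonical_words n d"
  let ?s = "\<lambda>w. Poly_Mapping.single w 1 :: free_alg"
  define r where "r = lin_ext (\<lambda>w. if w \<in> ?C then ?s w else 0)"
  have CW: "?C \<subseteq> words_over n d" by (auto simp: canonical_words_def)
  then have finC: "finite ?C" using finite_words_over finite_subset by blast
  have lookup_r: "Poly_Mapping.lookup (r f) w = (if w \<in> ?C then Poly_Mapping.lookup f w else 0)" for f w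
  proof -
    have "Poly_Mapping.lookup (r f) w =
        (\<Sum>v\<in>Poly_Mapping.keys f. if w = v then (if w \<in> ?C then Poly_Mapping.lookup f w else 0) else 0)"
      unfolding r_def lin_ext_def lookup_sum lookup_scale
      by (rule sum.cong) (auto simp: lookup_single when_def)
    then show ?thesis by (simp add: in_keys_iff)
  qed
  have lin: "Vector_Spaces.linear scale scale r" unfolding r_def by (rule linear_lin_ext)
  have "f = 0" if f: "f \<in> ?U" "r f = 0" for f
  proof (rule ccontr)
    assume "f \<noteq> 0"
    then obtain w where w: "w \<in> Poly_Mapping.keys f" by (metis ex_in_conv keys_eq_empty)
    then have "w \<in> words_over n d"
      using f(1) by (auto simp: partial_invariants_def invariants_def nc_homogeneous_iff)
    then obtain \<sigma> where \<sigma>: "\<sigma> permutes {1..n}" "map \<sigma> w \<in> ?C"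
      using canonical_word_exists by blast
    have "diagonal_action \<sigma> f = f"
      using f(1) \<sigma>(1) by (simp add: partial_invariants_def invariants_def sym_group_carrier)
    then have "Poly_Mapping.lookup f (map \<sigma> w) = Poly_Mapping.lookup f w"
      using lookup_relabelled[OF permutes_inj[OF \<sigma>(1)], of f w] by simp
    moreover have "Poly_Mapping.lookup f (map \<sigma> w) = 0"
      using lookup_r[of f "map \<sigma> w"] f(2) \<sigma>(2) by simp
    ultimately show False using w by (simp add: in_keys_iff)
  qed
  then have "{f \<in> ?U. r f = 0} \<subseteq> fa.span {}" by (auto simp: fa.span_zero)
  then have ker: "fa.dim {f \<in> ?U. r f = 0} = 0" using fa.dim_le_card[of _ "{}"] by fastforce
  have sub: "fa.subspace (r ` ?U)"
    by (rule fp.linear_subspace_image[OF lin subspace_partial_invariants])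
  have "r ` ?U = fa.span (?s ` ?C)"
  proof
    show "r ` ?U \<subseteq> fa.span (?s ` ?C)"
    proof clarify
      fix f
      have "(if w \<in> ?C then ?s w else 0) \<in> fa.span (?s ` ?C)" for w
        using fa.span_base[of "?s w" "?s ` ?C"] fa.span_zero by simp
      then show "r f \<in> fa.span (?s ` ?C)"
        unfolding r_def by (intro lin_ext_in_subspace[OF fa.subspace_span])
    qed
    have "?s w \<in> r ` ?U" if w: "w \<in> ?C" for w
    proof -
      \<comment> \<open>A preimage of the word \<open>w\<close> is the sum over its orbit.\<close>
      let ?O = "(\<lambda>\<sigma>. map \<sigma> w) ` {\<sigma>. \<sigma> permutes {1..n}}"
      define b where "b = (\<Sum>v\<in>?O. ?s v)"
      have OW: "?O \<subseteq> words_over n d"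
        using map_permutes_words_over w CW by blast
      have fO: "finite ?O" using OW finite_words_over finite_subset by blast
      have "b \<in> nc_homogeneous n d"
        unfolding b_def using OW
        by (intro fa.subspace_sum[OF subspace_nc_homogeneous]) (auto simp: word_in_nc_homogeneous)
      moreover have "diagonal_action \<tau> b = b" if t: "\<tau> permutes {1..n}" for \<tau>
      proof -
        have inj: "inj (map \<tau>)" using permutes_inj[OF t] by simp
        have mapO: "map \<tau> ` ?O \<subseteq> ?O"
        proof safe
          fix \<sigma> assume "\<sigma> permutes {1..n}"
          then have "\<tau> \<circ> \<sigma> permutes {1..n}" using t permutes_compose by blast
          then show "map \<tau> (map \<sigma> w) \<in> ?O" by auto
        qed
        have injO: "inj_on (map \<tau>) ?O" by (rule inj_on_subset[OF inj subset_UNIV])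
        have "bij_betw (map \<tau>) ?O ?O"
          unfolding bij_betw_def by (rule conjI[OF injO endo_inj_surj[OF fO mapO injO]])
        from sum.reindex_bij_betw[OF this, of ?s] show ?thesis
          by (simp only: b_def diagonal_action_lin_ext lin_ext_sum lin_ext_single)
      qed
      ultimately have "b \<in> ?U"
        by (simp add: partial_invariants_def invariants_def sym_group_carrier)
      moreover have "r b = ?s w"
      proof -
        have "?O \<inter> ?C = {w}"
        proof (intro equalityI subsetI)
          fix v assume "v \<in> {w}"
          moreover have "w = map id w" by simp
          ultimately show "v \<in> ?O \<inter> ?C" using w permutes_id by blast
        next
          fix v assume "v \<in> ?O \<inter> ?C"
          then show "v \<in> {w}" using canonical_word_unique[OF w] permutes_inj by blast
        qed
        moreover have "r b = (\<Sum>v\<in>?O. if v \<in> ?C then ?s v else 0)"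
          by (simp add: r_def b_def)
        ultimately show ?thesis using fO by (simp add: sum.If_cases Int_def[symmetric])
      qed
      ultimately show ?thesis by (metis imageI)
    qed
    then show "fa.span (?s ` ?C) \<subseteq> r ` ?U" by (intro fa.span_minimal[OF _ sub]) blast
  qed
  then have "fa.dim (r ` ?U) = card (?s ` ?C)"
    using fa.dim_span_eq_card_independent[OF independent_words[OF finC]] by simp
  also have "\<dots> = card ?C"
    by (rule card_image) (auto intro!: inj_onI dest: arg_cong[of _ _ Poly_Mapping.keys])
  finally show ?thesis
    using rank_nullity_homogeneous[OF lin subspace_partial_invariants, of n 0 d n d] ker
    by (auto simp: partial_invariants_def invariants_def)
qed

lemma cycle_generators_in_sym_group:
  "cycle_generators n \<subseteq> carrier (sym_group n)" "finite (cycle_generators n)"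
  using down_cycle_permutes by (auto simp: cycle_generators_def sym_group_carrier)

lemma dim_partial_invariants:
  assumes "n \<ge> 1" "j \<le> d"
  shows "fa.dim (partial_invariants n j d) =
         card (partial_words (sym_group n) (cycle_generators n) j d (one (sym_group n)))"
  using assms(2)
proof (induction j arbitrary: d)
  case 0
  show ?case
    by (simp only: dim_permutation_invariants partial_words_0 card_words_with_identity[OF assms(1)])
next
  case (Suc j)
  then obtain e where e: "d = Suc e" "j \<le> e" by (cases d) auto
  interpret monoid "sym_group n" using sym_group_is_group group.is_monoid by blast
  show ?case
    using dim_partial_invariants_step[OF assms(1) e(2)] Suc.IH[of "Suc e"] Suc.IH[of e] e
      card_partial_words_step[OF cycle_generators_in_sym_group e(2), of "one (sym_group n)"]
    by simp
qed

theorem corollary4p10: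
  fixes n d :: nat
  assumes "n \<ge> 2"
  shows "Vector_Spaces.linear scale scale nc_to_tensor \<and>
         bij_betw nc_to_tensor
           (invariants n nc_action (nc_homogeneous (n - 1) d))
           (invariants n diagonal_action (tensor_power (geometric_module n) d)) \<and>
         fa.dim (invariants n diagonal_action (tensor_power (geometric_module n) d)) =
           card (words_reducing_to (sym_group n) (cycle_generators n) d (one (sym_group n))) \<and>
         fa.dim (invariants n nc_action (nc_homogeneous (n - 1) d)) =
           card (words_reducing_to (sym_group n) (cycle_generators n) d (one (sym_group n)))"
proof -
  have n: "n \<ge> 1" using assms by simp
  have "fa.dim (invariants n diagonal_action (tensor_power (geometric_module n) d)) =
      card (words_reducing_to (sym_group n) (cycle_generators n) d (one (sym_group n)))"
    unfolding invariants_tensor_power dim_partial_invariants[OF n order_refl]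
      partial_words_full[OF one_notin_cycle_generators] ..
  then show ?thesis
    using linear_nc_to_tensor bij_betw_nc_to_tensor_invariants[OF n] dim_nc_invariants[OF n] by metis
qed

end
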